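(* Let $X_1, X_2, \dots$ be an i.i.d. sequence of $\mathbb{N}$-valued random variables on a probability space $(\Omega,\mathcal{F},\mathbf{P})$. Let $n\ge 1$ and let $(\nu_k)_{k\in\mathbb{N}}$ be non-negative integers with $\sum_{k\in\mathbb{N}}\nu_k=n$. Consider the event $$\mathcal{E}_{\{\nu_k\}}=\Big\{\sum_{\ell=1}^n \mathbf{1}_k(X_\ell)=\nu_k \text{ for all } k\in\mathbb{N}\Big\},$$ and suppose $\mathbf{P}(\mathcal{E}_{\{\nu_k\}})>0$. Then for every $m\in\mathbb{N}$ and every $1\le \ell\le n$, $$\mathbf{P}\big(X_\ell=m\,\big|\,\mathcal{E}_{\{\nu_k\}}\big)=\frac{\nu_m}{n}.$$
   Context: $\mathbf{1}_k(X_\ell)$ equals $1$ if $X_\ell=k$ and $0$ otherwise, so $\mathcal{E}_{\{\nu_k\}}$ is the event that the value $k$ occurs exactly $\nu_k$ times among $X_1,\dots,X_n$, for every $k$. *)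

theory Defs
  imports "HOL-Probability.Probability"
begin

definition occupancy_event ::
    "'a measure \<Rightarrow> (nat \<Rightarrow> 'a \<Rightarrow> nat) \<Rightarrow> nat \<Rightarrow> (nat \<Rightarrow> nat) \<Rightarrow> 'a set" where
  "occupancy_event M X n \<nu> =
    {\<omega> \<in> space M. \<forall>k. (\<Sum>l=1..n. indicator {k} (X l \<omega>)) = \<nu> k}"

end

theory Submission
  imports Defs "HOL-Combinatorics.Permutations"
begin

text \<open>Independent, identically distributed variables are exchangeable: their joint law is a power
  of one distribution, which permuting the coordinates does not change
  (\<open>iid_exchangeable\<close>). The occupancy event \<open>E\<close> depends only on how often each value occurs, so
  it is also unchanged when the indices are permuted. Swapping two indices therefore shows that
  \<open>P ({X i = m} \<inter> E)\<close> is the same number for every index \<open>i\<close>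
  (\<open>occupancy_joint_prob_eq\<close>). On \<open>E\<close> exactly \<open>\<nu> m\<close> of the \<open>n\<close> variables equal \<open>m\<close>, so these
  \<open>n\<close> equal numbers add up to \<open>\<nu> m * P E\<close> (\<open>occupancy_joint_prob_sum\<close>), and dividing
  by \<open>n * P E\<close> gives the claim.\<close>

text \<open>By independence the joint law is the product of the marginals, and reindexing a product
  measure along a permutation permutes its factors. The factors are all equal, so nothing
  changes.\<close>

lemma (in prob_space) iid_exchangeable:
  assumes indep: "indep_vars (\<lambda>_. N) X I"
    and ident: "\<And>i j. i \<in> I \<Longrightarrow> j \<in> I \<Longrightarrow> distr M N (X i) = distr M N (X j)"
    and p: "p permutes I"
  shows "distr M (PiM I (\<lambda>_. N)) (\<lambda>\<omega>. \<lambda>i\<in>I. X (p i) \<omega>) =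
         distr M (PiM I (\<lambda>_. N)) (\<lambda>\<omega>. \<lambda>i\<in>I. X i \<omega>)"
proof (cases "I = {}")
  case False
  let ?P = "PiM I (\<lambda>_. N)" and ?L = "\<lambda>i. distr M N (X i)"
  have rv: "random_variable N (X i)" if "i \<in> I" for i
    using indep that by (auto simp: indep_vars_def)
  have pI: "p i \<in> I" if "i \<in> I" for i
    using p that by (simp add: permutes_in_image)
  have joint: "distr M ?P (\<lambda>\<omega>. \<lambda>i\<in>I. X i \<omega>) = PiM I ?L"
    using False rv indep by (subst (asm) indep_vars_iff_distr_eq_PiM') auto
  have same: "PiM I (\<lambda>i. ?L (p i)) = PiM I ?L"
    by (intro PiM_cong refl ident pI)
  have sets_eq: "sets (PiM I (\<lambda>i. ?L (p i))) = sets ?P"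
    by (intro sets_PiM_cong) auto
  have reindex: "(\<lambda>f. \<lambda>i\<in>I. f (p i)) \<in> measurable ?P ?P"
    using pI by (intro measurable_restrict measurable_component_singleton)
  have X: "(\<lambda>\<omega>. \<lambda>i\<in>I. X i \<omega>) \<in> measurable M ?P"
    using rv by (intro measurable_restrict)
  have "distr M ?P (\<lambda>\<omega>. \<lambda>i\<in>I. X (p i) \<omega>) =
        distr M ?P ((\<lambda>f. \<lambda>i\<in>I. f (p i)) \<circ> (\<lambda>\<omega>. \<lambda>i\<in>I. X i \<omega>))"
    using pI by (intro distr_cong) auto
  also have "\<dots> = distr (PiM I ?L) ?P (\<lambda>f. \<lambda>i\<in>I. f (p i))"
    using distr_distr[OF reindex X] by (simp add: joint)
  also have "\<dots> = distr (PiM I ?L) (PiM I (\<lambda>i. ?L (p i))) (\<lambda>f. \<lambda>i\<in>I. f (p i))"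
    using sets_eq by (intro distr_cong) auto
  also have "\<dots> = PiM I (\<lambda>i. ?L (p i))"
    using rv pI permutes_inj_on[OF p] by (intro distr_PiM_reindex prob_space_distr) auto
  also have "\<dots> = distr M ?P (\<lambda>\<omega>. \<lambda>i\<in>I. X i \<omega>)"
    by (simp only: same joint)
  finally show ?thesis .
qed (simp add: restrict_def)

text \<open>A finite power of a countable discrete space is again discrete, so conditions on value
  counts, even for all values at once, are measurable.\<close>

lemma sets_PiM_count_space:
  fixes A :: "('i \<Rightarrow> 'b :: countable) set"
  assumes "finite I" and "A \<subseteq> space (PiM I (\<lambda>_. count_space UNIV))"
  shows "A \<in> sets (PiM I (\<lambda>_. count_space UNIV))"
  using assms by (simp add: count_space_PiM_finite)

lemma sum_indicator_restrict:
  "(\<Sum>l\<in>I. indicator B (restrict f I l)) = (\<Sum>l\<in>I. indicator B (f l))"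
  by (rule sum.cong) auto

lemma sets_occupancy_event:
  assumes "\<And>l. l \<in> {1..n} \<Longrightarrow> X l \<in> measurable M (count_space UNIV)"
  shows "occupancy_event M X n \<nu> \<in> sets M"
proof -
  let ?N = "PiM {1..n} (\<lambda>_. count_space (UNIV :: nat set))"
  let ?A = "{f \<in> space ?N. \<forall>k. (\<Sum>l=1..n. indicator {k} (f l)) = \<nu> k}"
  have X: "(\<lambda>\<omega>. \<lambda>i\<in>{1..n}. X i \<omega>) \<in> measurable M ?N"
    using assms by (intro measurable_restrict)
  have "?A \<in> sets ?N"
    by (rule sets_PiM_count_space) auto
  with X have "(\<lambda>\<omega>. \<lambda>i\<in>{1..n}. X i \<omega>) -` ?A \<inter> space M \<in> sets M"
    by (rule measurable_sets)
  also have "(\<lambda>\<omega>. \<lambda>i\<in>{1..n}. X i \<omega>) -` ?A \<inter> space M = occupancy_event M X n \<nu>"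
    by (auto simp: space_PiM occupancy_event_def sum_indicator_restrict
        simp del: restrict_apply One_nat_def)
  finally show ?thesis .
qed

text \<open>The transposition of \<open>i\<close> and \<open>j\<close> maps the event \<open>{X i = m} \<inter> E\<close>, where \<open>E\<close> is the
  occupancy event, to \<open>{X j = m} \<inter> E\<close>, so
  exchangeability makes them equally likely.\<close>

lemma (in prob_space) occupancy_joint_prob_eq:
  fixes X :: "nat \<Rightarrow> 'a \<Rightarrow> nat"
  assumes indep: "indep_vars (\<lambda>_. count_space UNIV) X {1..n}"
    and ident: "\<And>i j. i \<in> {1..n} \<Longrightarrow> j \<in> {1..n} \<Longrightarrow>
           distr M (count_space UNIV) (X i) = distr M (count_space UNIV) (X j)"
    and i: "i \<in> {1..n}" and j: "j \<in> {1..n}"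
  shows "prob {\<omega> \<in> space M. X i \<omega> = m \<and> \<omega> \<in> occupancy_event M X n \<nu>} =
         prob {\<omega> \<in> space M. X j \<omega> = m \<and> \<omega> \<in> occupancy_event M X n \<nu>}"
proof -
  define N where "N = PiM {1..n} (\<lambda>_. count_space (UNIV :: nat set))"
  define A where "A = {f \<in> space N. f i = m \<and> (\<forall>k. (\<Sum>l=1..n. indicator {k} (f l)) = \<nu> k)}"
  define p where "p = Transposition.transpose i j"
  have p: "p permutes {1..n}"
    unfolding p_def using i j by (rule permutes_swap_id)
  have A: "A \<in> sets N"
    unfolding N_def by (rule sets_PiM_count_space) (auto simp: A_def N_def)
  have rv: "random_variable (count_space UNIV) (X l)" if "l \<in> {1..n}" for l
    using indep that by (auto simp: indep_vars_def)
  \<comment> \<open>Occupancy counts are invariant under \<open>q\<close>, so the same set \<open>A\<close> of value vectors describes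
    the event for the original and for the permuted family.\<close>
  have law: "prob {\<omega> \<in> space M. X (q i) \<omega> = m \<and> \<omega> \<in> occupancy_event M X n \<nu>} =
      measure (distr M N (\<lambda>\<omega>. \<lambda>l\<in>{1..n}. X (q l) \<omega>)) A" if q: "q permutes {1..n}" for q
  proof -
    have Xq: "(\<lambda>\<omega>. \<lambda>l\<in>{1..n}. X (q l) \<omega>) \<in> measurable M N"
      unfolding N_def using rv permutes_in_image[OF q] by (intro measurable_restrict) auto
    have "(\<Sum>l=1..n. indicator {k} (X (q l) \<omega>)) =
        (\<Sum>l=1..n. indicator {k} (X l \<omega>) :: nat)" for k \<omega>
      using sum.permute[OF q, of "\<lambda>l. indicator {k} (X l \<omega>) :: nat"] by (simp add: comp_def)
    then have "(\<lambda>\<omega>. \<lambda>l\<in>{1..n}. X (q l) \<omega>) -` A \<inter> space M =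
        {\<omega> \<in> space M. X (q i) \<omega> = m \<and> \<omega> \<in> occupancy_event M X n \<nu>}"
      using i
      by (auto simp: A_def N_def space_PiM occupancy_event_def sum_indicator_restrict
            restrict_apply'[OF i] simp del: restrict_apply One_nat_def)
    then show ?thesis
      using Xq A by (simp add: measure_distr)
  qed
  have "prob {\<omega> \<in> space M. X (id i) \<omega> = m \<and> \<omega> \<in> occupancy_event M X n \<nu>} =
        prob {\<omega> \<in> space M. X (p i) \<omega> = m \<and> \<omega> \<in> occupancy_event M X n \<nu>}"
    unfolding law[OF p] law[OF permutes_id]
    using iid_exchangeable[OF indep ident p] by (simp add: N_def)
  then show ?thesis
    by (simp add: p_def)
qed

text \<open>The expectation of the number of indices with value \<open>m\<close>, restricted to the event: that
  number is the constant \<open>\<nu> m\<close> there.\<close>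

lemma (in prob_space) occupancy_joint_prob_sum:
  fixes X :: "nat \<Rightarrow> 'a \<Rightarrow> nat"
  assumes rv: "\<And>l. l \<in> {1..n} \<Longrightarrow> random_variable (count_space UNIV) (X l)"
  shows "(\<Sum>i=1..n. prob {\<omega> \<in> space M. X i \<omega> = m \<and> \<omega> \<in> occupancy_event M X n \<nu>}) =
         real (\<nu> m) * prob (occupancy_event M X n \<nu>)"
proof -
  define E where "E = occupancy_event M X n \<nu>"
  define B where "B i = {\<omega> \<in> space M. X i \<omega> = m \<and> \<omega> \<in> E}" for i
  have E[measurable]: "E \<in> sets M"
    unfolding E_def using rv by (rule sets_occupancy_event)
  have B: "B i \<in> sets M" if "i \<in> {1..n}" for i
  proof -
    note [measurable] = rv[OF that]
    show ?thesis unfolding B_def by measurable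
  qed
  have count: "(\<Sum>i=1..n. indicator (B i) \<omega>) = real (\<nu> m) * indicator E \<omega>" for \<omega>
  proof (cases "\<omega> \<in> E")
    case True
    then have "(\<Sum>i=1..n. indicator (B i) \<omega>) = (\<Sum>i=1..n. real (indicator {m} (X i \<omega>)))"
      by (intro sum.cong) (auto simp: B_def E_def occupancy_event_def indicator_def)
    also have "\<dots> = real (\<nu> m)"
      using True by (simp add: E_def occupancy_event_def flip: of_nat_sum)
    finally show ?thesis using True by simp
  qed (simp add: B_def)
  have "(\<Sum>i=1..n. prob (B i)) = (\<Sum>i=1..n. expectation (indicator (B i)))"
    using B by (intro sum.cong) auto
  also have "\<dots> = expectation (\<lambda>\<omega>. \<Sum>i=1..n. indicator (B i) \<omega>)"
    using B by (subst Bochner_Integration.integral_sum) (auto simp: emeasure_eq_measure)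
  also have "\<dots> = real (\<nu> m) * prob E"
    unfolding count by simp
  finally show ?thesis by (simp add: B_def E_def)
qed

theorem theorem1:
  fixes M :: "'a measure"
    and X :: "nat \<Rightarrow> 'a \<Rightarrow> nat"
    and n :: nat
    and \<nu> :: "nat \<Rightarrow> nat"
    and m l :: nat
  assumes "prob_space M"
    and "prob_space.indep_vars M (\<lambda>_. count_space UNIV) X {1..}"
    and "\<And>i j. 1 \<le> i \<Longrightarrow> 1 \<le> j \<Longrightarrow>
           distr M (count_space UNIV) (X i) = distr M (count_space UNIV) (X j)"
    and "n \<ge> 1"
    and "(\<lambda>k. real (\<nu> k)) sums real n"
    and "measure M (occupancy_event M X n \<nu>) > 0"
    and "1 \<le> l" and "l \<le> n"
  shows "\<P>(\<omega> in M. X l \<omega> = m \<bar> \<omega> \<in> occupancy_event M X n \<nu>) = real (\<nu> m) / real n"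
proof -
  interpret prob_space M by fact
  let ?E = "occupancy_event M X n \<nu>"
  let ?B = "\<lambda>i. {\<omega> \<in> space M. X i \<omega> = m \<and> \<omega> \<in> ?E}"
  have indep: "indep_vars (\<lambda>_. count_space UNIV) X {1..n}"
    using assms(2) by (rule indep_vars_subset) auto
  have "real n * prob (?B l) = (\<Sum>i=1..n. prob (?B l))"
    by simp
  also have "\<dots> = (\<Sum>i=1..n. prob (?B i))"
  proof (rule sum.cong)
    fix i assume "i \<in> {1..n}"
    with assms(7,8) show "prob (?B l) = prob (?B i)"
      by (intro occupancy_joint_prob_eq[OF indep assms(3)]) auto
  qed simp
  also have "\<dots> = real (\<nu> m) * prob ?E"
    using indep by (intro occupancy_joint_prob_sum) (auto simp: indep_vars_def)
  finally have "real n * prob (?B l) = real (\<nu> m) * prob ?E" .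
  moreover have "{\<omega> \<in> space M. \<omega> \<in> ?E} = ?E"
    by (auto simp: occupancy_event_def)
  ultimately show ?thesis
    using assms(4,6) by (simp add: cond_prob_def field_simps)
qed

end
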